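(* Let $f\colon\mathbb{R}^J\to\left]-\infty,+\infty\right]$ be a convex function of Legendre type, let $U=\operatorname{int}\operatorname{dom} f$, and let $C$ be a nonempty compact subset of $U$. Suppose that $C$ is $\overrightarrow{D}$-Klee, i.e., for every $x\in U$ the set $\overrightarrow{Q}_C(x)$ is a singleton. Then $C$ is a singleton.
   Context: $\mathbb{R}^J$ is the standard Euclidean space with inner product $\langle\cdot,\cdot\rangle$ and norm $\|\cdot\|$; $\operatorname{dom} g=\{x: g(x)\in\mathbb{R}\}$. A proper lower semicontinuous convex function $g\colon\mathbb{R}^J\to\left]-\infty,+\infty\right]$ with $\operatorname{int}\operatorname{dom} g\neq\varnothing$ is essentially smooth if $g$ is differentiable on $\operatorname{int}\operatorname{dom} g$ and $\|\nabla g(x)\|\to+\infty$ whenever $x\in\operatorname{int}\operatorname{dom} g$ approaches a point of the boundary of $\operatorname{dom} g$; it is essentially strictly convex if it is strictly convex on every convex subset of $\operatorname{dom}\partial g=\{x:\partial g(x)\neq\varnothing\}$, where $\partial g$ is the convex subdifferential; it is of Legendre type if it is both. The Bregman distance $D\colon\mathbb{R}^J\times\mathbb{R}^J\to[0,+\infty]$ of $f$ is $D(x,y)=f(x)-f(y)-\langle\nabla f(y),x-y\rangle$ if $y\in U$, and $D(x,y)=+\infty$ otherwise. For $\varnothing\neq C\subseteq U$, the right Bregman farthest-distance function is $\overrightarrow{F}_C(x)=\sup_{c\in C}D(x,c)$ for $x\in\mathbb{R}^J$, and the right Bregman farthest-point map is the set-valued map with $\overrightarrow{Q}_C(x)=\{c\in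 C: D(x,c)=\overrightarrow{F}_C(x)\}$ if $x\in\operatorname{dom} f$, and $\overrightarrow{Q}_C(x)=\varnothing$ otherwise. *)

theory Defs
  imports "HOL-Analysis.Analysis"
begin

definition dom_fin :: "('a \<Rightarrow> ereal) \<Rightarrow> 'a set" where
  "dom_fin g = {x. \<bar>g x\<bar> \<noteq> \<infinity>}"

definition proper_fun :: "('a \<Rightarrow> ereal) \<Rightarrow> bool" where
  "proper_fun g \<longleftrightarrow> (\<forall>x. g x \<noteq> -\<infinity>) \<and> (\<exists>x. g x \<noteq> \<infinity>)"

definition lower_semicont :: "('a::topological_space \<Rightarrow> ereal) \<Rightarrow> bool" where
  "lower_semicont g \<longleftrightarrow> (\<forall>x. g x \<le> Liminf (at x) g)"

text \<open>
  The convexity inequality is only meaningful for functions that omit the value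
  \<open>-\<infinity>\<close>; below it is always used together with \<open>proper_fun\<close>, so no
  sum \<open>\<infinity> + (-\<infinity>)\<close> occurs.
\<close>

definition convex_fun :: "('a::real_vector \<Rightarrow> ereal) \<Rightarrow> bool" where
  "convex_fun g \<longleftrightarrow> (\<forall>x y. \<forall>t::real. 0 < t \<and> t < 1 \<longrightarrow>
     g ((1 - t) *\<^sub>R x + t *\<^sub>R y) \<le> ereal (1 - t) * g x + ereal t * g y)"

definition strictly_convex_fun_on :: "'a::real_vector set \<Rightarrow> ('a \<Rightarrow> ereal) \<Rightarrow> bool" where
  "strictly_convex_fun_on S g \<longleftrightarrow> (\<forall>x\<in>S. \<forall>y\<in>S. \<forall>t::real. x \<noteq> y \<and> 0 < t \<and> t < 1 \<longrightarrow>
     g ((1 - t) *\<^sub>R x + t *\<^sub>R y) < ereal (1 - t) * g x + ereal t * g y)"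

definition subdifferential :: "('a::real_inner \<Rightarrow> ereal) \<Rightarrow> 'a \<Rightarrow> 'a set" where
  "subdifferential g x = {u. \<forall>y. g x + ereal (inner u (y - x)) \<le> g y}"

text \<open>
  Differentiability is that of the real-valued function obtained with \<open>real_of_ereal\<close>.
  It is only used at interior points of \<open>dom_fin g\<close>, near which this function agrees
  with \<open>g\<close>; off \<open>dom_fin g\<close> the value \<open>real_of_ereal (g x) = 0\<close> carries no meaning.
\<close>

definition grad :: "('a::euclidean_space \<Rightarrow> ereal) \<Rightarrow> 'a \<Rightarrow> 'a" where
  "grad g x = (THE v. GDERIV (\<lambda>y. real_of_ereal (g y)) x :> v)"

definition closed_convex_solid :: "('a::euclidean_space \<Rightarrow> ereal) \<Rightarrow> bool" where
  "closed_convex_solid g \<longleftrightarrow>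
     proper_fun g \<and> lower_semicont g \<and> convex_fun g \<and> interior (dom_fin g) \<noteq> {}"

definition essentially_smooth :: "('a::euclidean_space \<Rightarrow> ereal) \<Rightarrow> bool" where
  "essentially_smooth g \<longleftrightarrow> closed_convex_solid g \<and>
     (\<forall>x\<in>interior (dom_fin g). (\<lambda>y. real_of_ereal (g y)) differentiable (at x)) \<and>
     (\<forall>z\<in>frontier (dom_fin g).
        filterlim (\<lambda>x. norm (grad g x)) at_top (at z within interior (dom_fin g)))"

definition essentially_strictly_convex :: "('a::euclidean_space \<Rightarrow> ereal) \<Rightarrow> bool" where
  "essentially_strictly_convex g \<longleftrightarrow> closed_convex_solid g \<and>
     (\<forall>S. convex S \<and> S \<subseteq> {x. subdifferential g x \<noteq> {}} \<longrightarrow> strictly_convex_fun_on S g)"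

definition legendre :: "('a::euclidean_space \<Rightarrow> ereal) \<Rightarrow> bool" where
  "legendre g \<longleftrightarrow> essentially_smooth g \<and> essentially_strictly_convex g"

definition bregman :: "('a::euclidean_space \<Rightarrow> ereal) \<Rightarrow> 'a \<Rightarrow> 'a \<Rightarrow> ereal" where
  "bregman f x y =
     (if y \<in> interior (dom_fin f) then f x - f y - ereal (inner (grad f y) (x - y)) else \<infinity>)"

definition right_farthest_dist ::
    "('a::euclidean_space \<Rightarrow> ereal) \<Rightarrow> 'a set \<Rightarrow> 'a \<Rightarrow> ereal" where
  "right_farthest_dist f C x = (SUP c\<in>C. bregman f x c)"

definition right_farthest_points ::
    "('a::euclidean_space \<Rightarrow> ereal) \<Rightarrow> 'a set \<Rightarrow> 'a \<Rightarrow> 'a set" where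
  "right_farthest_points f C x =
     (if x \<in> dom_fin f then {c \<in> C. bregman f x c = right_farthest_dist f C x} else {})"

definition right_klee :: "('a::euclidean_space \<Rightarrow> ereal) \<Rightarrow> 'a set \<Rightarrow> bool" where
  "right_klee f C \<longleftrightarrow>
     (\<forall>x\<in>interior (dom_fin f). is_singleton (right_farthest_points f C x))"

end

theory Submission
  imports Defs
begin

text \<open>
  The farthest-point map \<open>q\<close> of a Klee set \<open>C\<close> sends the compact convex set
  \<open>convex hull C\<close>, which lies in the convex set \<open>U\<close>, into \<open>C\<close> itself. If \<open>q\<close> is
  continuous, Brouwer's theorem gives a point \<open>p\<close> which is its own farthest point in
  \<open>C\<close>. The largest of the Bregman distances from \<open>p\<close> to points of \<open>C\<close> is then
  \<open>D(p,p) = 0\<close>, and since \<open>D(p,c) > 0\<close> whenever \<open>c \<noteq> p\<close>, the set \<open>C\<close> contains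
  nothing but \<open>p\<close>.

  Continuity of \<open>q\<close> is a compactness argument: a unique maximizer over a compact set
  of a jointly continuous function depends continuously on the parameter
  (\<open>continuous_on_unique_maximizer\<close>). It applies to \<open>D\<close> because a differentiable
  convex function has a continuous gradient (\<open>convex_gradient_continuous\<close>). Both
  facts are obtained from the closed graph theorem for maps into compact sets:
  a gradient is the only subgradient, so the graph of the gradient is cut out by the
  subgradient inequalities, which are closed conditions. Positivity of \<open>D\<close> off the
  diagonal is strict convexity on \<open>U\<close>, where subgradients exist.
\<close>

section \<open>Gradients of differentiable convex functions\<close>

lemma GDERIV_unique:
  assumes "GDERIV g x :> a" "GDERIV g x :> b"
  shows "a = b"
proof -
  have "(\<lambda>h. inner h a) = (\<lambda>h. inner h b)"
    using assms unfolding gderiv_def by (rule has_derivative_unique)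
  then show ?thesis
    by (metis vector_eq_ldot)
qed

lemma differentiable_imp_GDERIV:
  fixes g :: "'a::euclidean_space \<Rightarrow> real"
  assumes "g differentiable (at x)"
  shows "\<exists>v. GDERIV g x :> v"
proof -
  obtain g' where g': "(g has_derivative g') (at x)"
    using assms by (auto simp: differentiable_def)
  then have "linear g'"
    by (rule has_derivative_linear)
  then have "g' = (\<lambda>h. inner h (adjoint g' 1))"
    using adjoint_works[of g'] by (auto simp: fun_eq_iff)
  with g' show ?thesis
    unfolding gderiv_def by metis
qed

text \<open>
  Along the segment from \<open>x\<close> to \<open>y\<close>, convexity bounds every difference quotient at \<open>x\<close>
  by \<open>g y - g x\<close>; their limit from the right is the directional derivative.
\<close>

lemma convex_on_gradient_inequality:
  fixes g :: "'a::euclidean_space \<Rightarrow> real"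
  assumes "convex_on S g" and x: "x \<in> S" and y: "y \<in> S" and "GDERIV g x :> v"
  shows "g x + inner v (y - x) \<le> g y"
proof -
  define k where "k = (\<lambda>t. g (x + t *\<^sub>R (y - x)))"
  have "((\<lambda>t::real. x + t *\<^sub>R (y - x)) has_derivative (\<lambda>t. t *\<^sub>R (y - x))) (at 0)"
    by (auto intro!: derivative_eq_intros)
  moreover have "(g has_derivative (\<lambda>h. inner h v)) (at (x + (0::real) *\<^sub>R (y - x)))"
    using assms(4) by (simp add: gderiv_def)
  ultimately have "(k has_derivative (\<lambda>t. inner (t *\<^sub>R (y - x)) v)) (at 0)"
    unfolding k_def by (rule has_derivative_compose)
  then have "(k has_field_derivative (inner v (y - x))) (at 0)"
    by (simp add: has_field_derivative_def inner_commute mult.commute[of "inner _ _"] mult_commute_abs)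
  then have "((\<lambda>t. (k t - k 0) / t) \<longlongrightarrow> inner v (y - x)) (at_right 0)"
    by (auto simp: has_field_derivative_iff intro: tendsto_within_subset)
  moreover have "\<forall>\<^sub>F t in at_right 0. (k t - k 0) / t \<le> g y - g x"
    unfolding eventually_at_right_field
  proof (intro exI[of _ "1::real"] conjI allI impI)
    fix t :: real assume t: "0 < t" "t < 1"
    have "g ((1 - t) *\<^sub>R x + t *\<^sub>R y) \<le> (1 - t) * g x + t * g y"
      using assms(1) x y t unfolding convex_on_def by auto
    moreover have "(1 - t) *\<^sub>R x + t *\<^sub>R y = x + t *\<^sub>R (y - x)"
      by (simp add: algebra_simps)
    ultimately have "k t - k 0 \<le> t * (g y - g x)"
      by (simp add: k_def algebra_simps)
    then show "(k t - k 0) / t \<le> g y - g x"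
      using t by (simp add: divide_le_eq mult.commute)
  qed simp
  ultimately have "inner v (y - x) \<le> g y - g x"
    by (intro tendsto_upperbound) auto
  then show ?thesis by simp
qed

text \<open>
  Subtracting the affine minorant of a subgradient leaves a function with a minimum at
  \<open>x\<close>, so its gradient at \<open>x\<close> vanishes.
\<close>

lemma subgradient_eq_gradient:
  fixes g :: "'a::euclidean_space \<Rightarrow> real"
  assumes "open S" "x \<in> S" "GDERIV g x :> v"
    and sub: "\<And>y. y \<in> S \<Longrightarrow> g x + inner w (y - x) \<le> g y"
  shows "w = v"
proof -
  have "((\<lambda>y. g y - inner y w) has_derivative (\<lambda>h. inner h v - inner h w)) (at x)"
    using assms(3) unfolding gderiv_def by (auto intro!: derivative_eq_intros)
  moreover have "\<forall>y\<in>S. g x - inner x w \<le> g y - inner y w"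
    using sub by (auto simp: inner_diff_right inner_commute algebra_simps)
  ultimately have "(\<lambda>h. inner h v - inner h w) = (\<lambda>h. 0)"
    using assms(1,2) by (intro differential_zero_maxmin) auto
  then show ?thesis
    by (metis eq_iff_diff_eq_0 vector_eq_ldot)
qed

text \<open>
  On a ball, gradients are bounded: stepping from \<open>x\<close> a distance \<open>r\<close> in the gradient
  direction raises a convex function by at least \<open>r\<close> times the norm of the gradient, and
  the function is bounded on the ball of twice the radius. The subgradient
  inequalities, being closed conditions that determine the gradient, then give a
  closed graph in a compact set.
\<close>

lemma convex_gradient_continuous:
  fixes g :: "'a::euclidean_space \<Rightarrow> real"
  assumes "open S" and conv: "convex_on S g"
    and der: "\<And>x. x \<in> S \<Longrightarrow> GDERIV g x :> G x"
  shows "continuous_on S G"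
proof -
  have ineq: "g x + inner (G x) (y - x) \<le> g y" if "x \<in> S" "y \<in> S" for x y
    using convex_on_gradient_inequality[OF conv that der[OF that(1)]] .
  have cont: "continuous_on S g"
    by (metis assms(1) der continuous_at_imp_continuous_on gderiv_def has_derivative_continuous)
  have "isCont G c" if "c \<in> S" for c
  proof -
    obtain e where "e > 0" and e: "cball c e \<subseteq> S"
      using \<open>open S\<close> \<open>c \<in> S\<close> open_contains_cball by blast
    define r where "r = e / 2"
    have "r > 0" using \<open>e > 0\<close> by (simp add: r_def)
    have B: "cball c r \<subseteq> S"
      using e \<open>e > 0\<close> by (auto simp: r_def subset_iff)
    have "bounded (g ` cball c e)"
      by (intro compact_imp_bounded compact_continuous_image continuous_on_subset[OF cont e]) simp
    then obtain M where M: "\<And>x. x \<in> cball c e \<Longrightarrow> \<bar>g x\<bar> \<le> M"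
      unfolding bounded_iff by (metis image_eqI real_norm_def)
    have bound: "norm (G x) \<le> 2 * M / r" if "x \<in> cball c r" for x
    proof -
      define y where "y = x + r *\<^sub>R sgn (G x)"
      have "dist x y \<le> r"
        using \<open>r > 0\<close> by (simp add: y_def dist_norm norm_sgn)
      then have "dist c y \<le> e"
        using that dist_triangle[of c y x] by (simp add: r_def)
      then have y: "y \<in> cball c e" by simp
      have x: "x \<in> cball c e"
        using that \<open>e > 0\<close> by (simp add: r_def)
      have "inner (G x) (y - x) = r * norm (G x)"
        by (cases "G x = 0") (simp_all add: y_def sgn_div_norm dot_square_norm power2_eq_square)
      then have "r * norm (G x) \<le> g y - g x"
        using ineq[OF subsetD[OF e x] subsetD[OF e y]] by simp
      also have "\<dots> \<le> 2 * M"
        using M[OF x] M[OF y] by linarith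
      finally show ?thesis
        using \<open>r > 0\<close> by (simp add: field_simps)
    qed
    let ?K = "cball c r \<times> cball (0::'a) (2 * M / r)"
    have "(\<lambda>x. (x, G x)) ` cball c r
        = ?K \<inter> (\<Inter>y\<in>S. {p \<in> ?K. g (fst p) + inner (snd p) (y - fst p) \<le> g y})"
      (is "_ = ?R")
    proof (intro equalityI subsetI)
      fix p assume "p \<in> (\<lambda>x. (x, G x)) ` cball c r"
      then show "p \<in> ?R"
        using bound ineq B by auto
    next
      fix p assume p: "p \<in> ?R"
      then have "fst p \<in> cball c r" and "fst p \<in> S"
        using B by auto
      moreover have "snd p = G (fst p)"
        using p by (intro subgradient_eq_gradient[OF \<open>open S\<close> \<open>fst p \<in> S\<close> der[OF \<open>fst p \<in> S\<close>]]) auto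
      ultimately show "p \<in> (\<lambda>x. (x, G x)) ` cball c r"
        by (intro image_eqI[of _ _ "fst p"]) (simp_all add: prod_eq_iff)
    qed
    moreover have "continuous_on ?K (\<lambda>p. g (fst p))"
      by (rule continuous_on_compose2[OF continuous_on_subset[OF cont B]])
        (auto intro: continuous_intros)
    then have "closed {p \<in> ?K. g (fst p) + inner (snd p) (y - fst p) \<le> g y}" for y
      by (intro continuous_on_closed_Collect_le continuous_intros closed_Times closed_cball)
    then have "closed ?R"
      by (intro closed_Int closed_INT closed_Times closed_cball ballI)
    ultimately have "continuous_on (cball c r) G"
      using bound by (intro continuous_from_closed_graph[of "cball 0 (2 * M / r)"]) auto
    then have "continuous_on (ball c r) G"
      by (rule continuous_on_subset) auto
    then show ?thesis
      using \<open>r > 0\<close> by (simp add: continuous_on_eq_continuous_at)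
  qed
  then show ?thesis
    by (simp add: continuous_at_imp_continuous_on)
qed

section \<open>Continuity of unique maximizers\<close>

text \<open>
  Uniqueness makes the graph of the maximizer equal to the set of all maximizing pairs,
  which is closed.
\<close>

lemma continuous_on_unique_maximizer:
  fixes k :: "'a::euclidean_space \<times> 'b::euclidean_space \<Rightarrow> real"
  assumes "closed S" "compact C" and cont: "continuous_on (S \<times> C) k"
    and q: "\<And>x. x \<in> S \<Longrightarrow> q x \<in> C"
    and max: "\<And>x c. x \<in> S \<Longrightarrow> c \<in> C \<Longrightarrow> k (x, c) \<le> k (x, q x)"
    and unique: "\<And>x c. x \<in> S \<Longrightarrow> c \<in> C \<Longrightarrow> k (x, c) = k (x, q x) \<Longrightarrow> c = q x"
  shows "continuous_on S q"
proof (rule continuous_from_closed_graph[OF \<open>compact C\<close>])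
  have "closed (S \<times> C)"
    using assms by (simp add: closed_Times compact_imp_closed)
  have "(\<lambda>x. (x, q x)) ` S
      = (S \<times> C) \<inter> (\<Inter>c\<in>C. {p \<in> S \<times> C. k (fst p, c) \<le> k p})" (is "_ = ?R")
  proof (intro equalityI subsetI)
    fix p assume p: "p \<in> ?R"
    then have x: "fst p \<in> S" and c: "snd p \<in> C" by auto
    then have "k (fst p, q (fst p)) \<le> k p"
      using p q by blast
    then have "snd p = q (fst p)"
      using max[OF x c] by (intro unique[OF x c]) simp
    then show "p \<in> (\<lambda>x. (x, q x)) ` S"
      using x by (intro image_eqI[of _ _ "fst p"]) (simp_all add: prod_eq_iff)
  qed (use q max in auto)
  moreover have "closed {p \<in> S \<times> C. k (fst p, c) \<le> k p}" if "c \<in> C" for c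
  proof (intro continuous_on_closed_Collect_le cont \<open>closed (S \<times> C)\<close>)
    show "continuous_on (S \<times> C) (\<lambda>p. k (fst p, c))"
      by (rule continuous_on_compose2[OF cont]) (use that in \<open>auto intro!: continuous_intros\<close>)
  qed
  then have "closed ?R"
    using \<open>closed (S \<times> C)\<close> by (intro closed_Int closed_INT ballI)
  ultimately show "closed ((\<lambda>x. (x, q x)) ` S)" by simp
qed (use q in auto)

section \<open>Legendre functions on the interior of their domain\<close>

lemma convex_fun_imp_convex_on:
  fixes g :: "'a::euclidean_space \<Rightarrow> ereal"
  assumes "proper_fun g" "convex_fun g"
  shows "convex_on (dom_fin g) (\<lambda>x. real_of_ereal (g x))"
proof -
  have key: "(1 - t) *\<^sub>R x + t *\<^sub>R y \<in> dom_fin g \<and>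
      real_of_ereal (g ((1 - t) *\<^sub>R x + t *\<^sub>R y))
        \<le> (1 - t) * real_of_ereal (g x) + t * real_of_ereal (g y)"
    if "0 < t" "t < 1" "x \<in> dom_fin g" "y \<in> dom_fin g" for t :: real and x y
  proof -
    let ?z = "(1 - t) *\<^sub>R x + t *\<^sub>R y"
    obtain a b where ab: "g x = ereal a" "g y = ereal b"
      using \<open>x \<in> dom_fin g\<close> \<open>y \<in> dom_fin g\<close> by (auto simp: dom_fin_def)
    have "g ?z \<le> ereal ((1 - t) * a + t * b)"
      using assms(2) \<open>0 < t\<close> \<open>t < 1\<close> ab unfolding convex_fun_def
      by (metis times_ereal.simps(1) plus_ereal.simps(1))
    moreover have "g ?z \<noteq> -\<infinity>"
      using assms(1) by (simp add: proper_fun_def)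
    ultimately show ?thesis
      using ab by (cases "g ?z") (auto simp: dom_fin_def)
  qed
  have "convex (dom_fin g)"
    unfolding convex_alt
  proof (intro ballI allI impI)
    fix x y and t :: real
    assume "x \<in> dom_fin g" "y \<in> dom_fin g" "0 \<le> t \<and> t \<le> 1"
    then show "(1 - t) *\<^sub>R x + t *\<^sub>R y \<in> dom_fin g"
      using key[of t x y] by (cases "t = 0 \<or> t = 1") auto
  qed
  with key show ?thesis
    by (intro convex_onI) auto
qed

lemma legendre_GDERIV_grad:
  assumes "legendre f" "x \<in> interior (dom_fin f)"
  shows "GDERIV (\<lambda>y. real_of_ereal (f y)) x :> grad f x"
proof -
  have "(\<lambda>y. real_of_ereal (f y)) differentiable (at x)"
    using assms by (auto simp: legendre_def essentially_smooth_def)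
  then obtain v where "GDERIV (\<lambda>y. real_of_ereal (f y)) x :> v"
    using differentiable_imp_GDERIV by blast
  then show ?thesis
    unfolding grad_def by (rule theI) (metis GDERIV_unique \<open>GDERIV _ _ :> v\<close>)
qed

lemma legendre_convex_on_interior:
  assumes "legendre f"
  shows "convex_on (interior (dom_fin f)) (\<lambda>x. real_of_ereal (f x))"
proof -
  have "convex_on (dom_fin f) (\<lambda>x. real_of_ereal (f x))"
    using assms by (intro convex_fun_imp_convex_on)
      (auto simp: legendre_def essentially_smooth_def closed_convex_solid_def)
  then show ?thesis
    by (meson convex_interior convex_on_imp_convex convex_on_subset interior_subset)
qed

text \<open>
  This places \<open>interior (dom_fin f)\<close> in the domain of the subdifferential, which is where
  essential strict convexity says something.
\<close>

lemma legendre_grad_subdifferential: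
  assumes leg: "legendre f" and x: "x \<in> interior (dom_fin f)"
  shows "grad f x \<in> subdifferential f x"
  unfolding subdifferential_def
proof (intro CollectI allI)
  fix y
  have pr: "proper_fun f" "convex_fun f"
    using leg by (auto simp: legendre_def essentially_smooth_def closed_convex_solid_def)
  have xd: "x \<in> dom_fin f"
    using x interior_subset by blast
  show "f x + ereal (inner (grad f x) (y - x)) \<le> f y"
  proof (cases "y \<in> dom_fin f")
    case True
    with xd obtain a b where ab: "f x = ereal a" "f y = ereal b"
      by (auto simp: dom_fin_def)
    then show ?thesis
      using convex_on_gradient_inequality[OF convex_fun_imp_convex_on[OF pr] xd True
          legendre_GDERIV_grad[OF leg x]]
      by simp
  next
    case False
    then have "f y = \<infinity>"
      using pr(1) by (auto simp: dom_fin_def proper_fun_def)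
    then show ?thesis by simp
  qed
qed

lemma bregman_interior:
  assumes "x \<in> interior (dom_fin f)" "y \<in> interior (dom_fin f)"
  shows "bregman f x y
    = ereal (real_of_ereal (f x) - real_of_ereal (f y) - inner (grad f y) (x - y))"
proof -
  have "x \<in> dom_fin f" "y \<in> dom_fin f"
    using assms interior_subset by blast+
  then show ?thesis
    using assms(2) by (auto simp: bregman_def dom_fin_def)
qed

text \<open>
  If \<open>D(x,y)\<close> were not positive, then at the midpoint \<open>m\<close> of \<open>x\<close> and \<open>y\<close> strict convexity
  would put \<open>f\<close> strictly below its tangent at \<open>y\<close>.
\<close>

lemma bregman_pos:
  assumes leg: "legendre f" and x: "x \<in> interior (dom_fin f)" and y: "y \<in> interior (dom_fin f)"
    and "x \<noteq> y"
  shows "0 < bregman f x y"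
proof -
  let ?U = "interior (dom_fin f)" and ?g = "\<lambda>x. real_of_ereal (f x)"
  define m where "m = (1 - 1/2) *\<^sub>R x + (1/2::real) *\<^sub>R y"
  have conv: "convex_on ?U ?g"
    using leg by (rule legendre_convex_on_interior)
  then have "convex ?U"
    by (rule convex_on_imp_convex)
  then have m: "m \<in> ?U"
    unfolding m_def by (intro convexD x y) auto
  have "?U \<subseteq> {x. subdifferential f x \<noteq> {}}"
    using legendre_grad_subdifferential[OF leg] by blast
  then have "strictly_convex_fun_on ?U f"
    using leg \<open>convex ?U\<close> by (auto simp: legendre_def essentially_strictly_convex_def)
  then have "f m < ereal (1 - 1/2) * f x + ereal (1/2) * f y"
    using x y \<open>x \<noteq> y\<close> unfolding strictly_convex_fun_on_def m_def
    by (elim ballE[of _ _ x] ballE[of _ _ y] allE[of _ "1/2"]) auto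
  moreover have "f z = ereal (?g z)" if "z \<in> ?U" for z
    using that interior_subset[of "dom_fin f"] by (auto simp: dom_fin_def ereal_real)
  then obtain a b d where "f x = ereal a" "f y = ereal b" "f m = ereal d"
    using m x y by blast
  ultimately have "?g m < (?g x + ?g y) / 2"
    by (simp add: field_simps)
  moreover have "?g y + inner (grad f y) (m - y) \<le> ?g m"
    by (rule convex_on_gradient_inequality[OF conv y m legendre_GDERIV_grad[OF leg y]])
  moreover have "m - y = (1/2) *\<^sub>R (x - y)"
    using scaleR_left_distrib[of "1/2" "1/2" y] by (simp add: m_def algebra_simps)
  then have "inner (grad f y) (m - y) = inner (grad f y) (x - y) / 2"
    by simp
  ultimately show ?thesis
    by (simp add: bregman_interior[OF x y])
qed

lemma continuous_on_bregman:
  assumes leg: "legendre f"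
  defines "U \<equiv> interior (dom_fin f)"
  shows "continuous_on (U \<times> U) (\<lambda>(x, y). real_of_ereal (bregman f x y))"
proof -
  let ?g = "\<lambda>x. real_of_ereal (f x)"
  have "open U" by (simp add: U_def)
  have der: "GDERIV ?g x :> grad f x" if "x \<in> U" for x
    using legendre_GDERIV_grad[OF leg] that by (simp add: U_def)
  have cg: "continuous_on U ?g"
    by (metis der continuous_at_imp_continuous_on gderiv_def has_derivative_continuous)
  have cG: "continuous_on U (grad f)"
    using legendre_convex_on_interior[OF leg]
    by (intro convex_gradient_continuous[OF \<open>open U\<close> _ der]) (auto simp: U_def)
  have "continuous_on (U \<times> U)
      (\<lambda>p. ?g (fst p) - ?g (snd p) - inner (grad f (snd p)) (fst p - snd p))"
    by (intro continuous_intros continuous_on_compose2[OF cg] continuous_on_compose2[OF cG]) auto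
  then show ?thesis
    by (rule continuous_on_eq) (auto simp: U_def bregman_interior)
qed

section \<open>Klee sets\<close>

theorem theorem3p2:
  fixes f :: "real ^ 'n \<Rightarrow> ereal" and U C :: "(real ^ 'n) set"
  assumes "legendre f"
    and "U = interior (dom_fin f)"
    and "C \<noteq> {}" and "compact C" and "C \<subseteq> U"
    and "right_klee f C"
  shows "is_singleton C"
proof -
  let ?H = "convex hull C"
  have "convex U"
    using legendre_convex_on_interior[OF assms(1)] assms(2) convex_on_imp_convex by blast
  then have H: "?H \<subseteq> U" and CH: "C \<subseteq> ?H"
    using \<open>C \<subseteq> U\<close> by (simp_all add: hull_minimal hull_subset)
  have "compact ?H"
    using \<open>compact C\<close> by (rule compact_convex_hull)
  define q where "q x = the_elem (right_farthest_points f C x)" for x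
  have Q: "{c \<in> C. bregman f x c = right_farthest_dist f C x} = {q x}" if "x \<in> U" for x
  proof -
    have "is_singleton (right_farthest_points f C x)"
      using assms(2,6) that by (simp add: right_klee_def)
    moreover have "x \<in> dom_fin f"
      using that assms(2) interior_subset by blast
    ultimately show ?thesis
      by (simp add: q_def right_farthest_points_def is_singleton_the_elem)
  qed
  have q: "q x \<in> C" if "x \<in> U" for x
    using Q[OF that] by blast
  have max: "bregman f x c \<le> bregman f x (q x)" if "x \<in> U" "c \<in> C" for x c
  proof -
    have "bregman f x (q x) = right_farthest_dist f C x"
      using Q[OF that(1)] by blast
    then show ?thesis
      using that(2) by (simp add: right_farthest_dist_def SUP_upper)
  qed
  have unique: "c = q x" if "x \<in> U" "c \<in> C" "bregman f x c = bregman f x (q x)" for x c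
  proof -
    have "bregman f x (q x) = right_farthest_dist f C x"
      using Q[OF that(1)] by blast
    then have "c \<in> {c \<in> C. bregman f x c = right_farthest_dist f C x}"
      using that(2,3) by simp
    then show ?thesis
      using Q[OF that(1)] by simp
  qed
  have fin: "\<exists>r. bregman f x c = ereal r" if "x \<in> U" "c \<in> C" for x c
    using that assms(2,5) bregman_interior[of x f c] by auto
  have "continuous_on ?H q"
  proof (rule continuous_on_unique_maximizer[where C = C and k = "\<lambda>(x, y). real_of_ereal (bregman f x y)"])
    show "continuous_on (?H \<times> C) (\<lambda>(x, y). real_of_ereal (bregman f x y))"
      by (rule continuous_on_subset[OF continuous_on_bregman[OF assms(1)]])
        (use H assms(2,5) in auto)
    fix x c assume "x \<in> ?H" "c \<in> C"
    then have x: "x \<in> U" using H by blast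
    obtain a b where ab: "bregman f x c = ereal a" "bregman f x (q x) = ereal b"
      using fin x \<open>c \<in> C\<close> q by blast
    then show "(case (x, c) of (x, y) \<Rightarrow> real_of_ereal (bregman f x y))
        \<le> (case (x, q x) of (x, y) \<Rightarrow> real_of_ereal (bregman f x y))"
      using max[OF x \<open>c \<in> C\<close>] by simp
    show "c = q x" if "(case (x, c) of (x, y) \<Rightarrow> real_of_ereal (bregman f x y))
        = (case (x, q x) of (x, y) \<Rightarrow> real_of_ereal (bregman f x y))"
      using that ab unique[OF x \<open>c \<in> C\<close>] by simp
  qed (use \<open>compact ?H\<close> \<open>compact C\<close> q H in \<open>auto intro: compact_imp_closed\<close>)
  then obtain p where p: "p \<in> ?H" "q p = p"
    using \<open>compact ?H\<close> \<open>C \<noteq> {}\<close> q H CH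
    by (elim brouwer[rotated 3]) auto
  then have "p \<in> U" "p \<in> C"
    using H q by force+
  have "c = p" if "c \<in> C" for c
  proof (rule ccontr)
    assume "c \<noteq> p"
    then have "0 < bregman f p c"
      using bregman_pos[OF assms(1), of p c] \<open>p \<in> U\<close> that assms(2,5) by blast
    also have "\<dots> \<le> bregman f p p"
      using max[OF \<open>p \<in> U\<close> that] p by simp
    also have "\<dots> = 0"
      using \<open>p \<in> U\<close> assms(2) by (simp add: bregman_interior zero_ereal_def)
    finally show False by simp
  qed
  then have "C = {p}"
    using \<open>p \<in> C\<close> by blast
  then show ?thesis
    by (simp add: is_singleton_def)
qed

end
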